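(* Let $\Omega\subseteq\mathbb{C}$ be a reflection-symmetric set that is modulus-closed and such that $I:=\Omega\cap[0,\infty)$ is an interval. Let $f:\Omega\to\mathbb{C}$. Then the following are equivalent: (1) $f[A]$ is positive definite for all positive definite $A\in M_2(\Omega)$. (2) The following conditions hold: (a) $f|_{I\setminus\{0\}}$ is real-valued, positive, increasing, and multiplicatively midconvex; (b) if $0\in I$, then the right-hand limit (over the reals) satisfies $f^{+}(0)\geq|f(0)|$; and (c) for all $z\in\Omega\setminus\{0\}$ such that there exists $\epsilon>0$ with $|z|+\epsilon\in I$, we have $f(|z|)\geq|f(z)|$ and $f(\overline{z})=\overline{f(z)}$. In particular, $f|_{I\setminus\{0\}}$ is then continuous except possibly at the upper-end point of $I$ (if it belongs to $I$).
   Context: $M_n(\Omega)$ denotes the set of $n\times n$ matrices with entries in $\Omega$, and $f[A]:=(f(a_{ij}))$ for $A=(a_{ij})$. Positive definite matrices are Hermitian by definition. $\Omega$ is reflection-symmetric if $z\in\Omega$ implies $\overline{z}\in\Omega$, and modulus-closed if $z\in\Omega$ implies $|z|\in\Omega$. A function $g:J\to[0,\infty)$ on an interval $J\subseteq[0,\infty)$ is multiplicatively midconvex if $\sqrt{g(x)g(y)}\geq g(\sqrt{xy})$ for all $x,y\in J$. "Increasing" means strictly increasing. $f^{+}(0):=\lim_{x\to 0^{+}}f(x)$, the limit being over positive reals $x\in I$.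
   Formalization: Condition (2) additionally requires f(0) to be real if 0 ∈ Ω (else f(z)=|z|+1 for z≠0, f(0)=i on ℂ is a counterexample), and the interval I is assumed not to be a single point (for the unit circle (1) is vacuous but (a) can fail). *)

theory Defs
  imports "HOL-Analysis.Analysis"
begin

definition hermitian :: "complex^'n^'n \<Rightarrow> bool" where
  "hermitian A \<longleftrightarrow> (\<forall>i j. A $ j $ i = cnj (A $ i $ j))"

text \<open>Reality of the quadratic form is automatic for Hermitian matrices, so taking \<open>Re\<close> loses nothing.\<close>

definition positive_definite :: "complex^'n^'n \<Rightarrow> bool" where
  "positive_definite A \<longleftrightarrow>
     hermitian A \<and>
     (\<forall>v :: complex^'n. v \<noteq> 0 \<longrightarrow> 0 < Re (\<Sum>i\<in>UNIV. \<Sum>j\<in>UNIV. cnj (v $ i) * A $ i $ j * v $ j))"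

definition matrices_over :: "complex set \<Rightarrow> (complex^'n^'n) set" where
  "matrices_over \<Omega> = {A. \<forall>i j. A $ i $ j \<in> \<Omega>}"

definition reflection_symmetric :: "complex set \<Rightarrow> bool" where
  "reflection_symmetric \<Omega> \<longleftrightarrow> (\<forall>z\<in>\<Omega>. cnj z \<in> \<Omega>)"

definition modulus_closed :: "complex set \<Rightarrow> bool" where
  "modulus_closed \<Omega> \<longleftrightarrow> (\<forall>z\<in>\<Omega>. of_real (cmod z) \<in> \<Omega>)"

definition mult_midconvex_on :: "real set \<Rightarrow> (real \<Rightarrow> real) \<Rightarrow> bool" where
  "mult_midconvex_on J g \<longleftrightarrow> (\<forall>x\<in>J. \<forall>y\<in>J. sqrt (g x * g y) \<ge> g (sqrt (x * y)))"

text \<open>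
  In the three conditions below, \<open>I\<close> is the set of nonnegative reals in the domain of \<open>f\<close>.
\<close>

definition cond_a :: "real set \<Rightarrow> (complex \<Rightarrow> complex) \<Rightarrow> bool" where
  "cond_a I f \<longleftrightarrow>
     (\<forall>x\<in>I - {0}. f (of_real x) \<in> \<real> \<and> 0 < Re (f (of_real x))) \<and>
     strict_mono_on (I - {0}) (\<lambda>x. Re (f (of_real x))) \<and>
     mult_midconvex_on (I - {0}) (\<lambda>x. Re (f (of_real x)))"

definition cond_b :: "real set \<Rightarrow> (complex \<Rightarrow> complex) \<Rightarrow> bool" where
  "cond_b I f \<longleftrightarrow>
     (0 \<in> I \<longrightarrow>
       (\<exists>L::real. ((\<lambda>x. f (of_real x)) \<longlongrightarrow> of_real L) (at 0 within I \<inter> {0<..}) \<and> L \<ge> cmod (f 0)))"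

text \<open>
  In the next condition \<open>f\<close> is real at \<open>\<bar>z\<bar>\<close> by \<^const>\<open>cond_a\<close>, as \<open>\<bar>z\<bar> \<in> I - {0}\<close> for a modulus-closed domain.
\<close>

definition cond_c :: "complex set \<Rightarrow> real set \<Rightarrow> (complex \<Rightarrow> complex) \<Rightarrow> bool" where
  "cond_c \<Omega> I f \<longleftrightarrow>
     (\<forall>z\<in>\<Omega> - {0}. (\<exists>\<epsilon>>0. cmod z + \<epsilon> \<in> I) \<longrightarrow>
        Re (f (of_real (cmod z))) \<ge> cmod (f z) \<and> f (cnj z) = cnj (f z))"

text \<open>
  Conditions (a)--(c) leave the argument of \<open>f 0\<close> free, but preserving Hermitian matrices with
  a zero off-diagonal entry forces \<open>f 0\<close> to be real: \<open>f z = \<bar>z\<bar> + 1\<close> for \<open>z \<noteq> 0\<close>, \<open>f 0 = \<i>\<close>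
  satisfies (a)--(c) on the whole plane yet maps the identity matrix to a non-Hermitian one. Hence this
  extra condition, the instance \<open>z = 0\<close> of the symmetry \<open>f (cnj z) = cnj (f z)\<close>.
\<close>

definition real_at_zero :: "complex set \<Rightarrow> (complex \<Rightarrow> complex) \<Rightarrow> bool" where
  "real_at_zero \<Omega> f \<longleftrightarrow> (0 \<in> \<Omega> \<longrightarrow> f 0 \<in> \<real>)"

end

theory Submission
  imports Defs
begin

text \<open>
  By the determinant criterion, \<open>f\<close> preserves positive definiteness of \<open>2 \<times> 2\<close> matrices iff
  \<open>\<bar>b\<bar>\<^sup>2 < a d\<close> entails \<open>\<bar>f b\<bar>\<^sup>2 < f a * f d\<close>, up to the reality and symmetry of the values. Comparing
  \<open>f q\<^sup>2\<close> with \<open>f x * f y\<close> for \<open>x < q < sqrt (x y)\<close> and letting \<open>y\<close> decrease to \<open>x\<close> gives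
  \<open>f\<^sup>+(x)\<^sup>2 \<le> f x * f\<^sup>+(x)\<close>, that is, right continuity. This turns the strict inequalities obtained from
  positive definite matrices into the weak ones in (a)--(c), which concern singular matrices; strict
  monotonicity gives the way back. Left continuity at \<open>x\<close> follows from
  \<open>f x\<^sup>2 \<le> f u * f (x\<^sup>2 / u)\<close> by letting \<open>u\<close> increase to \<open>x\<close>.
\<close>

section \<open>Determinant criterion for 2 x 2 matrices\<close>

lemma quadratic_form_2:
  fixes A :: "complex^2^2"
  shows "(\<Sum>i\<in>UNIV. \<Sum>j\<in>UNIV. cnj (v $ i) * A $ i $ j * v $ j) =
    cnj (v $ 1) * A $ 1 $ 1 * v $ 1 + cnj (v $ 1) * A $ 1 $ 2 * v $ 2
    + (cnj (v $ 2) * A $ 2 $ 1 * v $ 1 + cnj (v $ 2) * A $ 2 $ 2 * v $ 2)"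
  by (simp add: UNIV_2 add_ac)

lemma hermitian_2_iff:
  fixes A :: "complex^2^2"
  shows "hermitian A \<longleftrightarrow> A $ 1 $ 1 \<in> \<real> \<and> A $ 2 $ 2 \<in> \<real> \<and> A $ 2 $ 1 = cnj (A $ 1 $ 2)"
  by (auto simp: hermitian_def forall_2 Reals_cnj_iff)

text \<open>Completing the square: with diagonal entries \<open>a\<close>, \<open>d\<close> and
  upper off-diagonal entry \<open>b\<close>, the form \<open>q\<close> satisfies
  \<open>a * q v = |a v1 + b v2|^2 + (a d - |b|^2) |v2|^2\<close>. This turns questions about all
  vectors into one inequality between entries, the only form in which positive definiteness is used
  later.\<close>

lemma positive_definite_2_iff:
  fixes A :: "complex^2^2"
  shows "positive_definite A \<longleftrightarrow>
    A $ 1 $ 1 \<in> \<real> \<and> A $ 2 $ 2 \<in> \<real> \<and> A $ 2 $ 1 = cnj (A $ 1 $ 2) \<and>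
    0 < Re (A $ 1 $ 1) \<and> 0 < Re (A $ 2 $ 2) \<and>
    (cmod (A $ 1 $ 2))\<^sup>2 < Re (A $ 1 $ 1) * Re (A $ 2 $ 2)"
    (is "?L \<longleftrightarrow> ?R")
proof -
  define q where "q v = Re (\<Sum>i\<in>UNIV. \<Sum>j\<in>UNIV. cnj (v $ i) * A $ i $ j * v $ j)" for v :: "complex^2"
  have pd: "?L \<longleftrightarrow> hermitian A \<and> (\<forall>v. v \<noteq> 0 \<longrightarrow> 0 < q v)"
    by (simp add: positive_definite_def q_def)
  define a d b where "a = Re (A $ 1 $ 1)" and "d = Re (A $ 2 $ 2)" and "b = A $ 1 $ 2"
  have q: "q v = a * (cmod (v $ 1))\<^sup>2 + 2 * Re (cnj (v $ 1) * b * v $ 2) + d * (cmod (v $ 2))\<^sup>2"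
    if "hermitian A" for v
    using that unfolding hermitian_2_iff q_def quadratic_form_2 cmod_power2
    by (simp add: a_def d_def b_def complex_is_Real_iff power2_eq_square algebra_simps)
  show ?thesis
  proof
    assume L: ?L
    then have h: "hermitian A" and pos: "\<And>v. v \<noteq> 0 \<Longrightarrow> 0 < q v"
      by (auto simp: pd)
    have a: "0 < a"
      using pos[of "vector [1, 0]"] q[OF h, of "vector [1, 0]"] by (simp add: vec_eq_iff forall_2)
    have d: "0 < d"
      using pos[of "vector [0, 1]"] q[OF h, of "vector [0, 1]"] by (simp add: vec_eq_iff forall_2)
    \<comment> \<open>This vector makes the completed square \<open>|a v1 + b v2|^2\<close> vanish,
      so only the determinant term remains.\<close>
    let ?v = "vector [- b, of_real a] :: complex^2"
    have "0 < q ?v"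
      using pos a by (simp add: vec_eq_iff forall_2)
    also have "q ?v = a * (a * d - (cmod b)\<^sup>2)"
      unfolding q[OF h] by (simp add: cmod_power2) (simp add: power2_eq_square algebra_simps)
    finally have "(cmod b)\<^sup>2 < a * d"
      using a by (simp add: zero_less_mult_iff)
    with a d h show ?R
      by (simp add: hermitian_2_iff a_def d_def b_def)
  next
    assume R: ?R
    then have h: "hermitian A" and a: "0 < a" and d: "0 < d" and b: "0 < a * d - (cmod b)\<^sup>2"
      by (simp_all add: hermitian_2_iff a_def d_def b_def)
    have "0 < q v" if "v \<noteq> 0" for v
    proof -
      have sq: "a * q v = (cmod (a * v $ 1 + b * v $ 2))\<^sup>2 + (a * d - (cmod b)\<^sup>2) * (cmod (v $ 2))\<^sup>2"
        unfolding q[OF h] by (simp add: cmod_power2) (simp add: power2_eq_square algebra_simps)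
      have "0 < a * q v"
      proof (cases "v $ 2 = 0")
        case True
        with that have "v $ 1 \<noteq> 0"
          by (simp add: vec_eq_iff forall_2)
        with True a show ?thesis
          unfolding sq by simp
      next
        case False
        with b show ?thesis
          unfolding sq by (intro add_nonneg_pos mult_pos_pos) auto
      qed
      with a show ?thesis
        by (simp add: zero_less_mult_iff)
    qed
    with h show ?L
      by (simp add: pd)
  qed
qed

section \<open>Right continuity and midconvexity from strict determinant inequalities\<close>

text \<open>The infimum \<open>L\<close> of \<open>g\<close> on the right of \<open>x\<close> satisfies \<open>L\<^sup>2 \<le> g x * L\<close>.\<close>

lemma right_continuous_if_midpoint_bound:
  fixes g :: "real \<Rightarrow> real"
  assumes "x \<in> J" "0 < g x" "y0 \<in> J" "x < y0"
    and mono: "\<And>y. y \<in> J \<Longrightarrow> x < y \<Longrightarrow> g x \<le> g y"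
    and mid: "\<And>y. y \<in> J \<Longrightarrow> x < y \<Longrightarrow> \<exists>q\<in>J. x < q \<and> (g q)\<^sup>2 \<le> g x * g y"
    and "0 < e"
  obtains y where "y \<in> J" "x < y" "g y < g x + e"
proof -
  define S where "S = g ` (J \<inter> {x<..})"
  have ne: "S \<noteq> {}"
    using assms by (auto simp: S_def)
  have lower: "g x \<le> s" if "s \<in> S" for s
    using that mono by (auto simp: S_def)
  then have bdd: "bdd_below S"
    by (rule bdd_belowI)
  define L where "L = Inf S"
  have "g x \<le> L"
    unfolding L_def using ne lower by (rule cInf_greatest)
  \<comment> \<open>The point \<open>q\<close> supplied by \<open>mid\<close> also lies to the right
    of \<open>x\<close>, so \<open>g q\<close> is itself at least \<open>L\<close>. Hence
    \<open>L^2 / g x\<close> is a lower bound of \<open>S\<close> and cannot exceed the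
    infimum.\<close>
  have "L\<^sup>2 / g x \<le> s" if s: "s \<in> S" for s
  proof -
    obtain y where y: "y \<in> J" "x < y" "s = g y"
      using s by (auto simp: S_def)
    obtain q where q: "q \<in> J" "x < q" "(g q)\<^sup>2 \<le> g x * g y"
      using mid y by blast
    have "L \<le> g q"
      unfolding L_def using q bdd by (auto intro!: cInf_lower simp: S_def)
    then have "L\<^sup>2 \<le> (g q)\<^sup>2"
      using \<open>g x \<le> L\<close> \<open>0 < g x\<close> by (intro power_mono) auto
    then show ?thesis
      using q y \<open>0 < g x\<close> by (simp add: divide_simps mult.commute)
  qed
  then have "L\<^sup>2 / g x \<le> L"
    unfolding L_def using ne by (intro cInf_greatest) auto
  then have "L * L \<le> L * g x"
    using \<open>0 < g x\<close> by (simp add: divide_simps power2_eq_square)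
  then have "L \<le> g x"
    using \<open>g x \<le> L\<close> \<open>0 < g x\<close> by simp
  then have "Inf S < g x + e"
    using \<open>0 < e\<close> by (simp add: L_def)
  then show thesis
    using that ne bdd by (auto simp: cInf_less_iff S_def)
qed

lemma sqrt_mult_between:
  assumes "0 < x" "x < (y::real)"
  shows "x < sqrt (x * y)" "sqrt (x * y) < y"
proof -
  show "x < sqrt (x * y)"
    using assms by (intro real_less_rsqrt) (simp add: power2_eq_square)
  show "sqrt (x * y) < y"
    using assms by (intro real_less_lsqrt) (simp_all add: power2_eq_square)
qed

text \<open>The geometric mean of \<open>x\<close> and \<open>y\<close> is out of reach, since
  \<open>det\<close> needs \<open>c^2 < a * b\<close>; but the infimum argument accepts any
  \<open>q\<close> to the right of \<open>x\<close>, so one strictly between \<open>x\<close> and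
  \<open>sqrt (x * y)\<close> serves. As \<open>g\<close> increases, a single \<open>y\<close> with
  \<open>g y < g x + e\<close> expresses right continuity at \<open>x\<close>.\<close>

lemma strict_det_bound_imp_right_continuous:
  fixes g :: "real \<Rightarrow> real"
  assumes J: "is_interval J" "J \<subseteq> {0<..}"
    and pos: "\<And>x. x \<in> J \<Longrightarrow> 0 < g x"
    and mono: "strict_mono_on J g"
    and det: "\<And>a b c. \<lbrakk>a \<in> J; b \<in> J; c \<in> J; c\<^sup>2 < a * b\<rbrakk> \<Longrightarrow> (g c)\<^sup>2 < g a * g b"
    and x: "x \<in> J" "y0 \<in> J" "x < y0" and e: "0 < e"
  obtains y where "y \<in> J" "x < y" "g y < g x + e"
proof (rule right_continuous_if_midpoint_bound[of x J g y0 e])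
  fix y assume y: "y \<in> J" "x < y"
  have "0 < x"
    using x J by auto
  obtain q where q: "x < q" "q < sqrt (x * y)"
    using dense[OF sqrt_mult_between(1)[OF \<open>0 < x\<close> y(2)]] by blast
  have "q\<^sup>2 < x * y"
    using q \<open>0 < x\<close> power_strict_mono[of q "sqrt (x * y)" 2] y by simp
  moreover have "q \<in> J"
    using q x y sqrt_mult_between(2)[OF \<open>0 < x\<close> y(2)] mem_is_interval_1_I[OF J(1), of x y q] by simp
  ultimately show "\<exists>q\<in>J. x < q \<and> (g q)\<^sup>2 \<le> g x * g y"
    using q det x y by (meson less_imp_le)
qed (use x pos e strict_mono_onD[OF mono] that in \<open>auto intro: less_imp_le\<close>)

text \<open>Moving \<open>x\<close> slightly up to \<open>x'\<close> makes the singular case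
  \<open>c^2 = x * y\<close> strict; right continuity of \<open>g\<close> at \<open>x\<close> then
  removes the perturbation.\<close>

lemma strict_det_bound_imp_mult_midconvex:
  fixes g :: "real \<Rightarrow> real"
  assumes J: "is_interval J" "J \<subseteq> {0<..}"
    and pos: "\<And>x. x \<in> J \<Longrightarrow> 0 < g x"
    and mono: "strict_mono_on J g"
    and det: "\<And>a b c. \<lbrakk>a \<in> J; b \<in> J; c \<in> J; c\<^sup>2 < a * b\<rbrakk> \<Longrightarrow> (g c)\<^sup>2 < g a * g b"
  shows "mult_midconvex_on J g"
proof -
  \<comment> \<open>Taking \<open>x\<close> as the smaller argument ensures that \<open>J\<close>
    has a point above it, namely \<open>y\<close>, as right continuity requires.\<close>
  have less: "g (sqrt (x * y)) \<le> sqrt (g x * g y)" if xy: "x \<in> J" "y \<in> J" "x < y" for x y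
  proof (rule real_le_rsqrt, rule field_le_epsilon)
    fix e :: real assume "0 < e"
    \<comment> \<open>This tolerance becomes exactly \<open>e\<close> after multiplication by
      \<open>g y\<close>.\<close>
    then have "0 < e / g y"
      using pos xy by simp
    then obtain x' where x': "x' \<in> J" "x < x'" "g x' < g x + e / g y"
      using strict_det_bound_imp_right_continuous[OF J pos mono det xy] by blast
    have "0 < x" "0 < y"
      using xy J by auto
    then have "sqrt (x * y) \<in> J"
      using xy sqrt_mult_between[of x y] J(1) mem_is_interval_1_I[of J x y "sqrt (x * y)"] by simp
    then have "(g (sqrt (x * y)))\<^sup>2 < g x' * g y"
      using x' xy \<open>0 < x\<close> \<open>0 < y\<close> by (intro det) auto
    also have "\<dots> \<le> (g x + e / g y) * g y"
      using x' pos[OF xy(2)] by (intro mult_right_mono) auto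
    also have "\<dots> = g x * g y + e"
      using pos[OF xy(2)] by (simp add: field_simps)
    finally show "(g (sqrt (x * y)))\<^sup>2 \<le> g x * g y + e"
      by simp
  qed
  show ?thesis
    unfolding mult_midconvex_on_def
  proof (intro ballI)
    fix x y assume xy: "x \<in> J" "y \<in> J"
    then have "0 < x" "0 < g x"
      using J pos by auto
    then show "g (sqrt (x * y)) \<le> sqrt (g x * g y)"
      using less[of x y] less[of y x] xy
      by (cases x y rule: linorder_cases) (simp_all add: mult.commute)
  qed
qed

lemma mult_midconvex_onD:
  assumes "mult_midconvex_on J g" "x \<in> J" "y \<in> J" "0 < g x" "0 < g y" "0 < g (sqrt (x * y))"
  shows "(g (sqrt (x * y)))\<^sup>2 \<le> g x * g y"
proof -
  have "g (sqrt (x * y)) \<le> sqrt (g x * g y)"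
    using assms by (auto simp: mult_midconvex_on_def)
  then have "(g (sqrt (x * y)))\<^sup>2 \<le> (sqrt (g x * g y))\<^sup>2"
    using assms by (intro power_mono) auto
  then show ?thesis
    using assms by simp
qed

section \<open>Continuity away from the upper endpoint\<close>

text \<open>On the right, the infimum argument applies with the geometric mean itself as midpoint.
  On the left, the multiplicative reflection of \<open>u\<close> to \<open>x^2 / u\<close>, which
  fixes \<open>x\<close>, converts the upper bound on the right into a lower bound for
  \<open>g u\<close>.\<close>

lemma mult_midconvex_imp_continuous:
  fixes g :: "real \<Rightarrow> real"
  assumes J: "is_interval J" "J \<subseteq> {0<..}"
    and pos: "\<And>x. x \<in> J \<Longrightarrow> 0 < g x"
    and mono: "strict_mono_on J g"
    and mid: "mult_midconvex_on J g"
    and x: "x \<in> J" "y0 \<in> J" "x < y0"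
  shows "continuous (at x within J) g"
proof -
  have "0 < x"
    using x J by auto
  have in_J: "z \<in> J" if "x \<le> z" "z \<le> y" "y \<in> J" for y z
    using that x(1) J(1) mem_is_interval_1_I by blast
  have le: "g u \<le> g v" if "u \<in> J" "v \<in> J" "u \<le> v" for u v
    using that strict_mono_onD[OF mono, of u v] by (cases "u = v") auto
  have "\<forall>\<^sub>F u in at x within J. dist (g u) (g x) < e" if "0 < e" for e
  proof -
    obtain y where y: "y \<in> J" "x < y" "g y < g x + e"
    proof (rule right_continuous_if_midpoint_bound[of x J g y0 e])
      fix y assume y: "y \<in> J" "x < y"
      let ?q = "sqrt (x * y)"
      have q: "x < ?q" "?q \<in> J"
        using sqrt_mult_between[OF \<open>0 < x\<close> y(2)] y in_J[of ?q y] by auto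
      then show "\<exists>q\<in>J. x < q \<and> (g q)\<^sup>2 \<le> g x * g y"
        using mult_midconvex_onD[OF mid x(1) y(1)] pos x y by blast
    qed (use x pos that le \<open>0 < e\<close> in auto)
    have gx: "0 < g x"
      using pos x by simp
    \<comment> \<open>The window from \<open>x^2 / y\<close> to \<open>y\<close> is invariant under
      this reflection, so the mirror image of a point \<open>u < x\<close> lies between
      \<open>x\<close> and \<open>y\<close>, where \<open>g\<close> stays below
      \<open>g x + e\<close>.\<close>
    have "dist (g u) (g x) < e" if u: "u \<in> J" "x\<^sup>2 / y < u" "u < y" for u
    proof (cases "x \<le> u")
      case True
      then have "g x \<le> g u" "g u \<le> g y"
        using le x y u by auto
      with y show ?thesis
        by (simp add: dist_real_def)
    next
      case False
      have "0 < u" "0 < g u"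
        using u J pos by auto
      have "x\<^sup>2 / u < y"
        using u \<open>0 < u\<close> y \<open>0 < x\<close> by (simp add: field_simps)
      moreover have "x < x\<^sup>2 / u"
        using False \<open>0 < u\<close> \<open>0 < x\<close> by (simp add: power2_eq_square field_simps)
      ultimately have v: "x\<^sup>2 / u \<in> J" "x\<^sup>2 / u \<le> y"
        using in_J[of "x\<^sup>2 / u" y] y by auto
      have "sqrt (u * (x\<^sup>2 / u)) = x"
        using \<open>0 < u\<close> \<open>0 < x\<close> by simp
      then have "(g x)\<^sup>2 \<le> g u * g (x\<^sup>2 / u)"
        using mult_midconvex_onD[OF mid u(1) v(1)] pos u v gx by simp
      also have "\<dots> \<le> g u * (g x + e)"
        using le[OF v(1) y(1) v(2)] y \<open>0 < g u\<close> by (intro mult_left_mono) auto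
      finally have *: "(g x)\<^sup>2 \<le> g u * (g x + e)" .
      \<comment> \<open>Otherwise \<open>*\<close> would give
        \<open>(g x)^2 <= (g x)^2 - e^2\<close>.\<close>
      have "g x - e < g u"
      proof (rule ccontr)
        assume "\<not> g x - e < g u"
        then have "g u * (g x + e) \<le> (g x - e) * (g x + e)"
          using gx \<open>0 < e\<close> by (intro mult_right_mono) auto
        with * have "e\<^sup>2 \<le> 0"
          by (simp add: power2_eq_square algebra_simps)
        with \<open>0 < e\<close> show False
          by simp
      qed
      moreover have "g u \<le> g x"
        using le u x False by auto
      ultimately show ?thesis
        using \<open>0 < e\<close> by (simp add: dist_real_def)
    qed
    moreover have "x\<^sup>2 / y < x"
      using y \<open>0 < x\<close> by (simp add: power2_eq_square field_simps)
    then have "x \<in> {x\<^sup>2 / y<..<y}"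
      using y by simp
    ultimately show ?thesis
      unfolding eventually_at_topological
      by (intro exI[of _ "{x\<^sup>2 / y<..<y}"]) auto
  qed
  then show ?thesis
    unfolding continuous_within tendsto_iff by blast
qed

section \<open>Behaviour at zero\<close>

text \<open>A point \<open>y\<close> with \<open>g y < l\<close> forces \<open>g u < l\<close> for
  every smaller \<open>u\<close>, so values near 0 approach the infimum. The bound \<open>c\<close>
  makes \<open>Inf\<close> a genuine lower bound rather than an arbitrary value.\<close>

lemma mono_imp_tendsto_Inf_at_right_0:
  fixes g :: "real \<Rightarrow> real"
  assumes mono: "\<And>x y. \<lbrakk>x \<in> J; y \<in> J; x < y\<rbrakk> \<Longrightarrow> g x \<le> g y"
    and "J \<noteq> {}" "J \<subseteq> {0<..}" "\<And>x. x \<in> J \<Longrightarrow> c \<le> g x"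
  shows "(g \<longlongrightarrow> Inf (g ` J)) (at 0 within J)"
proof (rule order_tendstoI)
  have bdd: "bdd_below (g ` J)"
    using assms by (intro bdd_belowI[of _ c]) auto
  fix l assume l: "l < Inf (g ` J)"
  have "l < g u" if "u \<in> J" for u
    using cInf_lower[OF imageI[OF that, of g] bdd] l by simp
  then show "\<forall>\<^sub>F u in at 0 within J. l < g u"
    by (auto simp: eventually_at_filter)
next
  have bdd: "bdd_below (g ` J)"
    using assms by (intro bdd_belowI[of _ c]) auto
  fix l assume "Inf (g ` J) < l"
  then obtain y where y: "y \<in> J" "g y < l"
    using bdd \<open>J \<noteq> {}\<close> by (auto simp: cInf_less_iff)
  then have "g u < l" if "u \<in> J" "u < y" for u
    using mono[of u y] that by simp
  moreover have "0 < y"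
    using y assms by auto
  ultimately show "\<forall>\<^sub>F u in at 0 within J. g u < l"
    unfolding eventually_at_topological by (intro exI[of _ "{..<y}"]) auto
qed

lemma interval_Diff_0:
  fixes I :: "real set"
  assumes "is_interval I" "I \<subseteq> {0..}"
  shows "is_interval (I - {0})"
  unfolding is_interval_1
proof (intro ballI allI impI)
  fix a b x assume *: "a \<in> I - {0}" "b \<in> I - {0}" "a \<le> x \<and> x \<le> b"
  then have "x \<in> I"
    using mem_is_interval_1_I[OF assms(1)] by blast
  moreover have "0 < a"
    using * assms(2) by force
  ultimately show "x \<in> I - {0}"
    using * by simp
qed

section \<open>Preservation implies the conditions\<close>

text \<open>Each condition is read off from suitable choices of the diagonal \<open>a\<close>,
  \<open>d\<close> and the off-diagonal entry \<open>b\<close> in \<open>key\<close>; right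
  continuity then supplies the weak inequalities at singular matrices.\<close>

lemma conditions_if_preserves:
  fixes \<Omega> :: "complex set" and f :: "complex \<Rightarrow> complex"
  assumes refl: "reflection_symmetric \<Omega>" and modc: "modulus_closed \<Omega>"
    and I: "I = {x. 0 \<le> x \<and> of_real x \<in> \<Omega>}" and "is_interval I" and nsing: "\<not> is_singleton I"
    and pres: "\<And>A :: complex^2^2. A \<in> matrices_over \<Omega> \<Longrightarrow> positive_definite A \<Longrightarrow>
      positive_definite (map_matrix f A)"
  shows "cond_a I f \<and> cond_b I f \<and> cond_c \<Omega> I f \<and> real_at_zero \<Omega> f"
proof -
  define J where "J = I - {0}"
  define g where "g x = Re (f (of_real x))" for x
  have J: "is_interval J" "J \<subseteq> {0<..}"
    using interval_Diff_0[OF \<open>is_interval I\<close>] by (auto simp: I J_def)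
  have key: "f a \<in> \<real> \<and> 0 < g a \<and> 0 < g d \<and> f (cnj b) = cnj (f b) \<and> (cmod (f b))\<^sup>2 < g a * g d"
    if "a \<in> J" "d \<in> J" "b \<in> \<Omega>" "(cmod b)\<^sup>2 < a * d" for a d b
  proof -
    let ?A = "vector [vector [of_real a, b], vector [cnj b, of_real d]] :: complex^2^2"
    have "0 < a" "0 < d"
      using that J by auto
    have "?A \<in> matrices_over \<Omega>"
      using that refl by (auto simp: matrices_over_def forall_2 reflection_symmetric_def I J_def)
    moreover have "positive_definite ?A"
      using that \<open>0 < a\<close> \<open>0 < d\<close> by (simp add: positive_definite_2_iff)
    ultimately have "positive_definite (map_matrix f ?A)"
      by (rule pres)
    then show ?thesis
      by (simp add: positive_definite_2_iff g_def)
  qed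
  have other: "\<exists>y\<in>I. y \<noteq> x" if "x \<in> I" for x
    using nsing that unfolding is_singleton_def by blast
  have real_pos: "f x \<in> \<real> \<and> 0 < g x" if x: "x \<in> J" for x
  proof -
    obtain y where y: "y \<in> I" "y \<noteq> x"
      using other x by (auto simp: J_def)
    have "0 < x"
      using x J by auto
    show ?thesis
    \<comment> \<open>A second point of \<open>I\<close> completes a positive definite matrix having
      \<open>x\<close> on its diagonal. If \<open>y\<close> is larger, it is the other diagonal
      entry and \<open>x\<close> is repeated off the diagonal; if smaller, and possibly 0, it goes
      off the diagonal.\<close>
    proof (cases "x < y")
      case True
      then show ?thesis
        using key[of x y x] x y \<open>0 < x\<close> by (auto simp: J_def I power2_eq_square)
    next
      case False
      then have "y\<^sup>2 < x * x"
        using y power_strict_mono[of y x 2] by (simp add: I power2_eq_square)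
      then show ?thesis
        using key[of x x y] x y by (auto simp: I)
    qed
  qed
  have det: "(g c)\<^sup>2 < g a * g b" if "a \<in> J" "b \<in> J" "c \<in> J" "c\<^sup>2 < a * b" for a b c
  proof -
    have "(cmod (f c))\<^sup>2 < g a * g b"
      using key[of a b c] that by (auto simp: J_def I)
    then show ?thesis
      using power_mono[OF abs_Re_le_cmod[of "f c"], of 2] by (simp add: g_def)
  qed
  have mono: "strict_mono_on J g"
  proof (rule strict_mono_onI)
    fix x y assume xy: "x \<in> J" "y \<in> J" "x < y"
    then have "(g x)\<^sup>2 < g x * g y"
      using J by (intro det) (auto simp: power2_eq_square)
    then show "g x < g y"
      using real_pos xy by (simp add: power2_eq_square)
  qed
  have a: "cond_a I f"
    using real_pos mono strict_det_bound_imp_mult_midconvex[OF J _ mono det]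
    unfolding cond_a_def J_def[symmetric] g_def by blast
  \<comment> \<open>With 0 off the diagonal, the image is Hermitian only if \<open>f 0\<close>
    equals its own conjugate.\<close>
  have zero: "f 0 \<in> \<real> \<and> cmod (f 0) < g x" if "0 \<in> I" "x \<in> J" for x
  proof -
    have "0 < x"
      using that J by auto
    then have *: "f (cnj 0) = cnj (f 0) \<and> (cmod (f 0))\<^sup>2 < g x * g x"
      using key[of x x 0] that by (simp add: I)
    then have "cmod (f 0) < g x"
      using real_pos[OF that(2)] by (metis power2_eq_square power2_less_imp_less less_imp_le)
    with * show ?thesis
      by (simp add: Reals_cnj_iff)
  qed
  have b: "cond_b I f"
    unfolding cond_b_def
  proof
    assume "0 \<in> I"
    have ne: "J \<noteq> {}"
      using other[OF \<open>0 \<in> I\<close>] by (auto simp: J_def)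
    have lim: "(g \<longlongrightarrow> Inf (g ` J)) (at 0 within J)"
      using ne J strict_mono_onD[OF mono] zero[OF \<open>0 \<in> I\<close>]
      by (intro mono_imp_tendsto_Inf_at_right_0[where c = "cmod (f 0)"]) (auto intro: less_imp_le)
    have "I \<inter> {0<..} = J"
      by (auto simp: J_def I)
    moreover have "((\<lambda>x. f (of_real x)) \<longlongrightarrow> of_real (Inf (g ` J))) (at 0 within J)"
    proof (rule Lim_transform_eventually)
      show "((\<lambda>x. complex_of_real (g x)) \<longlongrightarrow> of_real (Inf (g ` J))) (at 0 within J)"
        using lim by (rule tendsto_of_real)
      show "\<forall>\<^sub>F x in at 0 within J. complex_of_real (g x) = f (of_real x)"
        using real_pos by (auto simp: eventually_at_filter g_def)
    qed
    moreover have "cmod (f 0) \<le> Inf (g ` J)"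
      using ne zero[OF \<open>0 \<in> I\<close>] by (intro cInf_greatest) (auto intro: less_imp_le)
    ultimately show "\<exists>L::real. ((\<lambda>x. f (of_real x)) \<longlongrightarrow> of_real L) (at 0 within I \<inter> {0<..}) \<and> L \<ge> cmod (f 0)"
      by auto
  qed
  have c: "cond_c \<Omega> I f"
    unfolding cond_c_def
  proof (intro ballI impI)
    fix z assume z: "z \<in> \<Omega> - {0}" and "\<exists>\<epsilon>>0. cmod z + \<epsilon> \<in> I"
    then obtain \<epsilon> where \<epsilon>: "0 < \<epsilon>" "cmod z + \<epsilon> \<in> I"
      by blast
    have zJ: "cmod z \<in> J"
      using z modc by (auto simp: J_def I modulus_closed_def)
    have s0: "cmod z + \<epsilon> \<in> J"
      using \<epsilon> add_nonneg_pos[OF norm_ge_zero[of z] \<epsilon>(1)] unfolding J_def by simp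
    have above: "f (cnj z) = cnj (f z) \<and> cmod (f z) < g s" if "s \<in> J" "cmod z < s" for s
    proof -
      have "(cmod z)\<^sup>2 < s * s"
        using that power_strict_mono[of "cmod z" s 2] by (simp add: power2_eq_square)
      then have *: "f (cnj z) = cnj (f z) \<and> (cmod (f z))\<^sup>2 < g s * g s"
        using key[of s s z] that z by simp
      then have "cmod (f z) < g s"
        using real_pos[OF that(1)] by (metis power2_eq_square power2_less_imp_less less_imp_le)
      with * show ?thesis
        by simp
    qed
    \<comment> \<open>Diagonal entries \<open>s = |z|\<close> would give a singular matrix, so
      \<open>above\<close> covers only \<open>s > |z|\<close>. Letting \<open>s\<close> decrease to
      \<open>|z|\<close> uses right continuity there; the point \<open>|z| + \<epsilon>\<close>
      shows that \<open>|z|\<close> is not the upper end of \<open>J\<close>.\<close>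
    have "cmod (f z) \<le> g (cmod z)"
    proof (rule field_le_epsilon)
      fix e :: real assume "0 < e"
      then obtain s where "s \<in> J" "cmod z < s" "g s < g (cmod z) + e"
        using strict_det_bound_imp_right_continuous[OF J _ mono _ zJ s0, of e] real_pos det \<epsilon>
        by auto
      with above[of s] show "cmod (f z) \<le> g (cmod z) + e"
        by simp
    qed
    then show "cmod (f z) \<le> Re (f (of_real (cmod z))) \<and> f (cnj z) = cnj (f z)"
      using above[OF s0] \<epsilon> by (simp add: g_def)
  qed
  have "real_at_zero \<Omega> f"
    unfolding real_at_zero_def
  proof
    assume "0 \<in> \<Omega>"
    then have "0 \<in> I"
      by (simp add: I)
    moreover obtain x where "x \<in> J"
      using other[OF \<open>0 \<in> I\<close>] by (auto simp: J_def)
    ultimately show "f 0 \<in> \<real>"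
      using zero by blast
  qed
  with a b c show ?thesis
    by blast
qed

section \<open>The conditions imply preservation\<close>

text \<open>For an off-diagonal entry \<open>w\<close> other than 0, put
  \<open>r = sqrt (p * d)\<close>: then \<open>|f w| <= g |w| < g r <= sqrt (g p * g d)\<close> by
  (c), strict monotonicity and midconvexity in turn. For \<open>w = 0\<close> the right-hand limit
  from (b) takes the place of \<open>g |w|\<close>.\<close>

lemma preserves_if_conditions:
  fixes \<Omega> :: "complex set" and f :: "complex \<Rightarrow> complex" and A :: "complex^2^2"
  assumes modc: "modulus_closed \<Omega>"
    and I: "I = {x. 0 \<le> x \<and> of_real x \<in> \<Omega>}" and "is_interval I"
    and a: "cond_a I f" and b: "cond_b I f" and c: "cond_c \<Omega> I f" and zero: "real_at_zero \<Omega> f"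
    and A: "A \<in> matrices_over \<Omega>" "positive_definite A"
  shows "positive_definite (map_matrix f A)"
proof -
  define g where "g x = Re (f (of_real x))" for x
  have real_pos: "f x \<in> \<real> \<and> 0 < g x" if "x \<in> I" "x \<noteq> 0" for x
    using a that by (simp add: cond_a_def g_def)
  have mono: "g x < g y" if "x \<in> I" "y \<in> I" "0 < x" "x < y" for x y
    using a that by (simp add: cond_a_def g_def strict_mono_on_def)
  have mid: "mult_midconvex_on (I - {0}) g"
    using a by (simp add: cond_a_def g_def [abs_def])
  define p d w where "p = Re (A $ 1 $ 1)" and "d = Re (A $ 2 $ 2)" and "w = A $ 1 $ 2"
  have A11: "A $ 1 $ 1 = of_real p" and A22: "A $ 2 $ 2 = of_real d" and A21: "A $ 2 $ 1 = cnj w"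
    and p: "0 < p" and d: "0 < d" and det: "(cmod w)\<^sup>2 < p * d"
    using A(2) by (auto simp: positive_definite_2_iff p_def d_def w_def)
  have pI: "p \<in> I" and dI: "d \<in> I" and w: "w \<in> \<Omega>"
    using A(1) p d by (auto simp: matrices_over_def I A11[symmetric] A22[symmetric] w_def)
  have "f (cnj w) = cnj (f w) \<and> (cmod (f w))\<^sup>2 < g p * g d"
  proof (cases "w = 0")
    case True
    then have "0 \<in> I"
      using w by (simp add: I)
    then obtain L :: real
      where L: "((\<lambda>x. f (of_real x)) \<longlongrightarrow> of_real L) (at 0 within I \<inter> {0<..})" "cmod (f 0) \<le> L"
      using b by (auto simp: cond_b_def)
    have lim: "(g \<longlongrightarrow> L) (at 0 within I \<inter> {0<..})"
      using tendsto_Re[OF L(1)] by (simp add: g_def [abs_def])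
    \<comment> \<open>A limit alone preserves only weak inequalities; passing through
      \<open>y / 2\<close> gives \<open>L <= g (y / 2) < g y\<close>.\<close>
    have below: "L < g y" if y: "y \<in> I" "0 < y" for y
    proof -
      have I': "x \<in> I" if "0 \<le> x" "x \<le> y" for x
        using that y \<open>0 \<in> I\<close> \<open>is_interval I\<close> mem_is_interval_1_I by blast
      \<comment> \<open>Since \<open>I\<close> contains everything from 0 to \<open>y\<close>, the
        filter is the usual one-sided one, hence nontrivial, and bounds pass to the limit.\<close>
      have "at 0 within I \<inter> {0<..} = at_right 0"
        using y I' by (intro at_within_nhd[of 0 "{..<y}"]) auto
      then have lim': "(g \<longlongrightarrow> L) (at_right 0)"
        using lim by simp
      have "\<forall>\<^sub>F x in at_right 0. g x \<le> g (y / 2)"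
        unfolding eventually_at_right_field
      proof (intro exI[of _ "y / 2"] conjI allI impI)
        fix x assume "0 < x" "x < y / 2"
        then show "g x \<le> g (y / 2)"
          using mono[of x "y / 2"] I' by simp
      qed (use y in simp)
      then have "L \<le> g (y / 2)"
        using lim' by (intro tendsto_upperbound[OF lim']) auto
      also have "\<dots> < g y"
        using mono[of "y / 2" y] I' y by simp
      finally show ?thesis .
    qed
    have "(cmod (f 0))\<^sup>2 \<le> L * L"
      using L(2) by (auto simp: power2_eq_square intro: mult_mono order_trans[OF norm_ge_zero])
    also have "\<dots> < g p * g d"
      using below[OF pI p] below[OF dI d] L(2) norm_ge_zero[of "f 0"]
      by (intro mult_strict_mono') linarith+
    finally show ?thesis
      using zero w True by (simp add: real_at_zero_def Reals_cnj_iff)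
  next
    case False
    define r where "r = sqrt (p * d)"
    have r: "cmod w < r"
      using det unfolding r_def by (rule real_less_rsqrt)
    have "min p d \<le> r" "r \<le> max p d"
      using p d sqrt_mult_between[of p d] sqrt_mult_between[of d p]
      unfolding r_def by (cases p d rule: linorder_cases; simp add: mult.commute)+
    moreover have "min p d \<in> I" "max p d \<in> I"
      using pI dI by (auto simp: min_def max_def)
    ultimately have rI: "r \<in> I"
      using \<open>is_interval I\<close> mem_is_interval_1_I by blast
    have wI: "cmod w \<in> I"
      using w modc by (auto simp: I modulus_closed_def)
    \<comment> \<open>The determinant inequality places \<open>r\<close> strictly above
      \<open>|w|\<close>, and \<open>r\<close> belongs to \<open>I\<close> as a mean of
      \<open>p\<close> and \<open>d\<close>. So (c) applies to \<open>w\<close>.\<close>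
    have "\<exists>\<epsilon>>0. cmod w + \<epsilon> \<in> I"
      using r rI by (intro exI[of _ "r - cmod w"]) simp
    then have fw: "cmod (f w) \<le> g (cmod w)" "f (cnj w) = cnj (f w)"
      using c w False by (auto simp: cond_c_def g_def)
    have "g (cmod w) < g r"
      using mono wI rI r False by simp
    with fw have "(cmod (f w))\<^sup>2 < (g r)\<^sup>2"
      by (intro power_strict_mono) auto
    also have "\<dots> \<le> g p * g d"
      unfolding r_def
      using mult_midconvex_onD[OF mid, of p d] real_pos pI dI rI p d by (simp add: r_def)
    finally show ?thesis
      using fw by simp
  qed
  then show ?thesis
    using real_pos[OF pI] real_pos[OF dI] p d
    by (simp add: positive_definite_2_iff A11 A22 A21 w_def[symmetric] g_def)
qed

text \<open>One-point intervals are excluded because they can make preservation vacuous. If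
  \<open>I = {1}\<close>, all entries have modulus 1, no 2 x 2 matrix over \<Omega> is positive
  definite, and yet \<open>cond_a\<close> demands that \<open>f 1\<close> be real and
  positive.\<close>

theorem proposition2p1:
  fixes \<Omega> :: "complex set" and I :: "real set" and f :: "complex \<Rightarrow> complex"
  assumes "reflection_symmetric \<Omega>"
    and "modulus_closed \<Omega>"
    and "I = {x. 0 \<le> x \<and> of_real x \<in> \<Omega>}"
    and "is_interval I"
    and "\<not> is_singleton I"
  shows "((\<forall>A :: complex^2^2. A \<in> matrices_over \<Omega> \<and> positive_definite A \<longrightarrow> positive_definite (map_matrix f A))
           \<longleftrightarrow> cond_a I f \<and> cond_b I f \<and> cond_c \<Omega> I f \<and> real_at_zero \<Omega> f)
       \<and> (cond_a I f \<and> cond_b I f \<and> cond_c \<Omega> I f \<longrightarrow>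
           (\<forall>x\<in>I - {0}. (\<exists>y\<in>I. x < y) \<longrightarrow>
              continuous (at x within I - {0}) (\<lambda>x. f (of_real x))))"
proof (intro conjI impI ballI)
  show "(\<forall>A :: complex^2^2. A \<in> matrices_over \<Omega> \<and> positive_definite A \<longrightarrow> positive_definite (map_matrix f A))
           \<longleftrightarrow> cond_a I f \<and> cond_b I f \<and> cond_c \<Omega> I f \<and> real_at_zero \<Omega> f"
    using conditions_if_preserves[OF assms, of f] preserves_if_conditions[OF assms(2-4), of f] by blast
next
  fix x assume "cond_a I f \<and> cond_b I f \<and> cond_c \<Omega> I f" and x: "x \<in> I - {0}" and "\<exists>y\<in>I. x < y"
  then obtain y where a: "cond_a I f" and y: "y \<in> I" "x < y"
    by blast
  define J where "J = I - {0}"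
  define g where "g x = Re (f (of_real x))" for x
  have J: "is_interval J" "J \<subseteq> {0<..}"
    using interval_Diff_0[OF assms(4)] by (auto simp: assms(3) J_def)
  have "y \<in> J"
    using x y by (auto simp: J_def assms(3))
  \<comment> \<open>By \<open>cond_a\<close>, \<open>f\<close> is real on \<open>J\<close>, so
    continuity of its real part \<open>g\<close> suffices; \<open>y\<close> witnesses that
    \<open>x\<close> is not the upper endpoint.\<close>
  then have "continuous (at x within J) g"
    using a x y by (intro mult_midconvex_imp_continuous[OF J]) (auto simp: cond_a_def g_def [abs_def] J_def)
  then have "continuous (at x within J) (\<lambda>x. complex_of_real (g x))"
    by (rule continuous_of_real)
  moreover have eq: "complex_of_real (g u) = f (of_real u)" if "u \<in> J" for u
    using a that by (simp add: cond_a_def J_def g_def)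
  ultimately show "continuous (at x within I - {0}) (\<lambda>x. f (of_real x))"
    using continuous_transform_within[of x J _ 1] x unfolding J_def
    by (metis zero_less_one)
qed

end
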